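(* Consider the general propagation multiple-relaxation-time lattice Boltzmann (GPMRT-LB) model $$\mathbf m^{n+1}=\mathbf A\,\mathbf m^{n}+\mathbf B\,\mathbf m^{eq,n}+\Delta t\,\mathbf W\tilde{\mathbf F}^{n},\qquad n\in\mathbb N=\{0,1,2,\dots\},$$ in the case of $N=1$ conservative moment, $m_1$. Let $\gamma_1,\dots,\gamma_{q+1}\in\mathcal R$ (with $\gamma_{q+1}=1$) be the coefficients of the monic characteristic polynomial $p_{\mathbf A}(x)=\det(x\mathbf I_q-\mathbf A)=\sum_{k=1}^{q+1}\gamma_k x^{k-1}$ of $\mathbf A$. Then the model can be written as a multiple-level finite-difference scheme on $m_1$: for every $n\ge q-1$, $$m_1^{n+1}=-\sum_{k=1}^{q}\gamma_k\, m_1^{\,n+k-q}+\sum_{k=1}^{q}\Big[\sum_{l=1}^{k}\gamma_{q+1+l-k}\,\mathbf A^{l-1}\big(\mathbf B\,\mathbf m^{eq,n-k+1}+\Delta t\,\mathbf W\tilde{\mathbf F}^{n-k+1}\big)\Big]_1,$$ or, in an alternative form, for every $n\in\mathbb N$, $$\det\big(T^1_{\Delta t}\mathbf I_q-\mathbf A\big)\,m_1^n=\Big[\mathrm{adj}\big(T^1_{\Delta t}\mathbf I_q-\mathbf A\big)\big(\mathbf B\,\mathbf m^{eq,n}+\Delta t\,\mathbf W\tilde{\mathbf F}^n\big)\Big]_1 .$$ Here $[\cdot]_1$ denotes the first component and $\mathrm{adj}$ the adjugate matrix.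
   Context: Lattice and operators. Let $d\in\{1,2,3\}$, $q\ge 1$, $\Delta x,\Delta t>0$, $\mathcal L=\Delta x\,\mathbb Z^d$. For $\mathbf z\in\mathbb Z^d$ the space shift is $(T^{\mathbf z}_{\Delta x}h)(\mathbf x)=h(\mathbf x+\mathbf z\Delta x)$ for $h:\mathcal L\to\mathbb R$. Let $\mathcal R$ be the commutative ring of operators generated over $\mathbb R$ by all space shifts. For sequences $(h^n)_{n\in\mathbb N}$ of functions on $\mathcal L$ the time shift is $T^1_{\Delta t}h^n=h^{n+1}$; it commutes with $\mathcal R$, and determinants and adjugates of matrices over $\mathcal R[T^1_{\Delta t}]$ are taken in this commutative ring. Matrices over this ring act on vector-valued sequences in the obvious way. Model data. $\mathbf e_1,\dots,\mathbf e_q\in\mathbb Z^d$ are the discrete velocity directions; $a,b\in\mathbb R$ with $0<a\le1$, $a^2\le b\le 1$; $p_0=1-b$, $p_{-1}=\frac{a+b}{2}$, $p_1=\frac{b-a}{2}$. $\mathbf M$ (transform matrix) and $\mathbf S$ (relaxation matrix) are real invertible $q\times q$ matrices, independent of space and time. Put $$\overline{\mathbf T}=p_0\mathbf I_q+p_{-1}\,\mathrm{diag}(T^{-\mathbf e_1}_{\Delta x},\dots,T^{-\mathbf e_q}_{\Delta x})+p_1\,\mathrm{diag}(T^{\mathbf e_1}_{\Delta x},\dots,T^{\mathbf e_q}_{\Delta x}),$$ $$\mathbf W=\mathbf M\overline{\mathbf T}\mathbf M^{-1},\quad \mathbf A=\mathbf W(\mathbf I_q-\mathbf S),\quad \mathbf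 B=\mathbf W\mathbf S .$$ For $n\in\mathbb N$, $\mathbf m^n,\mathbf m^{eq,n},\tilde{\mathbf F}^n:\mathcal L\to\mathbb R^q$ are the vectors of moments, equilibrium moments and source/force moments at time $t_n=n\Delta t$ (i.e. $\mathbf m=\mathbf M\mathbf f$, $\mathbf m^{eq}=\mathbf M\mathbf f^{eq}$, $\tilde{\mathbf F}=\mathbf M(\mathbf G+\mathbf F+\frac{\Delta t}{2}\overline{\mathbf D}\mathbf F)$ for distribution functions $\mathbf f,\mathbf f^{eq}$ and source terms $\mathbf G,\mathbf F$); $\mathbf m^{eq,n}$ and $\tilde{\mathbf F}^n$ are treated as given sequences. The first $N$ moments are the conservative ones: $m_l^{eq,n}=m_l^n$ for $1\le l\le N$. *)

theory Defs
  imports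
    "HOL-Analysis.Finite_Cartesian_Product"
    "Jordan_Normal_Form.Char_Poly"
    "Jordan_Normal_Form.Gauss_Jordan_Elimination"
begin

section \<open>Lattice\<close>

definition lattice_vec :: "real \<Rightarrow> int ^ 'd \<Rightarrow> real ^ 'd" where
  "lattice_vec dx z = (\<chi> i. dx * of_int (vec_nth z i))"

definition space_lattice :: "real \<Rightarrow> (real ^ 'd) set" where
  "space_lattice dx = range (lattice_vec dx)"

section \<open>The commutative ring of space-time shift operators\<close>

text \<open>
  A sequence \<open>(h\<^sup>n)\<close> of functions is a curried function of the time level \<open>n\<close> and the position
  \<open>x\<close>. Since a type cannot depend on the lattice spacing, functions on the lattice are represented
  by functions on the whole space whose values off the lattice are irrelevant, and the operator
  type below is generated by the time shift and the space shifts for all spacings at once. The ring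
  of a fixed spacing is its subring \<open>space_ring dx\<close> defined below; determinants and adjugates do
  not depend on whether they are taken in that subring extended by the time shift or in the
  surrounding commutative ring.
\<close>

type_synonym 'd field_seq = "nat \<Rightarrow> real ^ 'd \<Rightarrow> real"

inductive_set shift_algebra :: "(('d::finite) field_seq \<Rightarrow> 'd field_seq) set" where
  space: "(\<lambda>h n x. h n (x + v)) \<in> shift_algebra"
| time: "(\<lambda>h n x. h (Suc n) x) \<in> shift_algebra"
| scale: "P \<in> shift_algebra \<Longrightarrow> (\<lambda>h n x. c * P h n x) \<in> shift_algebra"
| add: "P \<in> shift_algebra \<Longrightarrow> Q \<in> shift_algebra \<Longrightarrow> (\<lambda>h n x. P h n x + Q h n x) \<in> shift_algebra"
| comp: "P \<in> shift_algebra \<Longrightarrow> Q \<in> shift_algebra \<Longrightarrow> (\<lambda>h. P (Q h)) \<in> shift_algebra"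

lemma shift_algebra_zero: "(\<lambda>h n x. 0) \<in> shift_algebra"
  using shift_algebra.scale[OF shift_algebra.time, of 0] by simp

lemma shift_algebra_id: "(\<lambda>h. h) \<in> shift_algebra"
  using shift_algebra.space[of 0] by simp

lemma shift_algebra_add_arg:
  "P \<in> shift_algebra \<Longrightarrow> P (\<lambda>n x. h n x + k n x) = (\<lambda>n x. P h n x + P k n x)"
proof (induction arbitrary: h k rule: shift_algebra.induct)
  case (scale P c)
  show ?case by (simp only: scale.IH distrib_left)
next
  case (add P Q)
  show ?case by (simp only: add.IH ac_simps)
next
  case (comp P Q)
  show ?case by (simp only: comp.IH)
qed auto

lemma shift_algebra_scale_arg:
  "P \<in> shift_algebra \<Longrightarrow> P (\<lambda>n x. c * h n x) = (\<lambda>n x. c * P h n x)"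
proof (induction arbitrary: h rule: shift_algebra.induct)
  case (scale P c')
  show ?case by (simp only: scale.IH ac_simps)
next
  case (add P Q)
  show ?case by (simp only: add.IH distrib_left)
next
  case (comp P Q)
  show ?case by (simp only: comp.IH)
qed auto

lemma shift_algebra_commute_space:
  "P \<in> shift_algebra \<Longrightarrow> P (\<lambda>n x. h n (x + v)) = (\<lambda>n x. P h n (x + v))"
proof (induction arbitrary: h rule: shift_algebra.induct)
  case (space w)
  show ?case by (simp add: ac_simps)
next
  case (scale P c)
  show ?case by (simp only: scale.IH)
next
  case (add P Q)
  show ?case by (simp only: add.IH)
next
  case (comp P Q)
  show ?case by (simp only: comp.IH)
qed auto

lemma shift_algebra_commute_time:
  "P \<in> shift_algebra \<Longrightarrow> P (\<lambda>n x. h (Suc n) x) = (\<lambda>n x. P h (Suc n) x)"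
proof (induction arbitrary: h rule: shift_algebra.induct)
  case (scale P c)
  show ?case by (simp only: scale.IH)
next
  case (add P Q)
  show ?case by (simp only: add.IH)
next
  case (comp P Q)
  show ?case by (simp only: comp.IH)
qed auto

lemma shift_algebra_commute:
  "Q \<in> shift_algebra \<Longrightarrow> P \<in> shift_algebra \<Longrightarrow> P (Q h) = Q (P h)"
proof (induction arbitrary: h rule: shift_algebra.induct)
  case (space v)
  then show ?case by (simp only: shift_algebra_commute_space)
next
  case time
  then show ?case by (simp only: shift_algebra_commute_time)
next
  case (scale Q c)
  then show ?case by (simp only: shift_algebra_scale_arg)
next
  case (add Q R)
  then show ?case by (simp only: shift_algebra_add_arg)
next
  case (comp Q R)
  then show ?case by simp
qed

typedef (overloaded) ('d::finite) shift_op = "shift_algebra :: ('d field_seq \<Rightarrow> 'd field_seq) set"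
  morphisms op_app Abs_shift_op
  using shift_algebra_id by blast

setup_lifting type_definition_shift_op

instantiation shift_op :: (finite) comm_ring_1
begin

lift_definition zero_shift_op :: "'a shift_op" is "\<lambda>h n x. 0"
  by (rule shift_algebra_zero)

lift_definition one_shift_op :: "'a shift_op" is "\<lambda>h. h"
  by (rule shift_algebra_id)

lift_definition plus_shift_op :: "'a shift_op \<Rightarrow> 'a shift_op \<Rightarrow> 'a shift_op"
  is "\<lambda>P Q h n x. P h n x + Q h n x"
  by (rule shift_algebra.add)

lift_definition uminus_shift_op :: "'a shift_op \<Rightarrow> 'a shift_op"
  is "\<lambda>P h n x. - P h n x"
  using shift_algebra.scale[where c = "-1"] by simp

lift_definition minus_shift_op :: "'a shift_op \<Rightarrow> 'a shift_op \<Rightarrow> 'a shift_op"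
  is "\<lambda>P Q h n x. P h n x - Q h n x"
  using shift_algebra.add[OF _ shift_algebra.scale[where c = "-1"]] by simp

lift_definition times_shift_op :: "'a shift_op \<Rightarrow> 'a shift_op \<Rightarrow> 'a shift_op"
  is "\<lambda>P Q h. P (Q h)"
  by (rule shift_algebra.comp)

instance
proof
  fix P Q R :: "'a shift_op"
  show "P * Q * R = P * (Q * R)" by transfer simp
  show "P * Q = Q * P" by transfer (simp add: fun_eq_iff shift_algebra_commute)
  show "1 * P = P" by transfer simp
  show "P + Q + R = P + (Q + R)" by transfer (simp add: ac_simps)
  show "P + Q = Q + P" by transfer (simp add: ac_simps)
  show "0 + P = P" by transfer simp
  show "- P + P = 0" by transfer simp
  show "P - Q = P + - Q" by transfer simp
  show "(P + Q) * R = P * R + Q * R" by transfer simp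
  show "(0 :: 'a shift_op) \<noteq> 1"
    by transfer (auto simp: fun_eq_iff intro: exI[of _ "\<lambda>n x. 1"])
qed

end

instantiation shift_op :: (finite) real_algebra_1
begin

lift_definition scaleR_shift_op :: "real \<Rightarrow> 'a shift_op \<Rightarrow> 'a shift_op"
  is "\<lambda>c P h n x. c * P h n x"
  by (rule shift_algebra.scale)

instance
proof
  fix P Q :: "'a shift_op" and c c' :: real
  show "c *\<^sub>R (P + Q) = c *\<^sub>R P + c *\<^sub>R Q" by transfer (simp add: distrib_left)
  show "(c + c') *\<^sub>R P = c *\<^sub>R P + c' *\<^sub>R P" by transfer (simp add: distrib_right)
  show "c *\<^sub>R c' *\<^sub>R P = (c * c') *\<^sub>R P" by transfer (simp add: ac_simps)
  show "1 *\<^sub>R P = P" by transfer simp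
  show "c *\<^sub>R P * Q = c *\<^sub>R (P * Q)" by transfer simp
  show "P * c *\<^sub>R Q = c *\<^sub>R (P * Q)" by transfer (simp add: shift_algebra_scale_arg)
qed

end

lift_definition space_shift :: "real \<Rightarrow> int ^ 'd \<Rightarrow> ('d::finite) shift_op"
  is "\<lambda>dx z h n x. h n (x + lattice_vec dx z)"
  by (rule shift_algebra.space)

lift_definition time_shift :: "('d::finite) shift_op"
  is "\<lambda>h n x. h (Suc n) x"
  by (rule shift_algebra.time)

inductive_set space_ring :: "real \<Rightarrow> ('d::finite) shift_op set" for dx :: real where
  const: "of_real c \<in> space_ring dx"
| shift: "space_shift dx z \<in> space_ring dx"
| add: "P \<in> space_ring dx \<Longrightarrow> Q \<in> space_ring dx \<Longrightarrow> P + Q \<in> space_ring dx"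
| mult: "P \<in> space_ring dx \<Longrightarrow> Q \<in> space_ring dx \<Longrightarrow> P * Q \<in> space_ring dx"

section \<open>Operator matrices acting on vector-valued sequences\<close>

type_synonym 'd vec_seq = "nat \<Rightarrow> real ^ 'd \<Rightarrow> real Matrix.vec"

text \<open>Vector components and matrix entries are numbered from \<open>0\<close>.\<close>

definition component :: "'d vec_seq \<Rightarrow> nat \<Rightarrow> 'd field_seq" where
  "component u i = (\<lambda>n x. vec_index (u n x) i)"

definition mat_app :: "('d::finite) shift_op mat \<Rightarrow> 'd vec_seq \<Rightarrow> 'd vec_seq" where
  "mat_app P u = (\<lambda>n x. Matrix.vec (dim_row P)
     (\<lambda>i. \<Sum>j<dim_col P. op_app (P $$ (i, j)) (component u j) n x))"

section \<open>Model matrices\<close>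

definition T_bar :: "real \<Rightarrow> real \<Rightarrow> real \<Rightarrow> nat \<Rightarrow> (nat \<Rightarrow> int ^ 'd) \<Rightarrow> ('d::finite) shift_op mat" where
  "T_bar dx a b q e =
     of_real (1 - b) \<cdot>\<^sub>m 1\<^sub>m q
     + of_real ((a + b) / 2) \<cdot>\<^sub>m mat_diag q (\<lambda>j. space_shift dx (- e j))
     + of_real ((b - a) / 2) \<cdot>\<^sub>m mat_diag q (\<lambda>j. space_shift dx (e j))"

text \<open>\<open>mat_inverse\<close> returns an option; it is \<open>Some\<close> of the inverse for every invertible \<open>M\<close>.\<close>

definition W_mat ::
  "real \<Rightarrow> real \<Rightarrow> real \<Rightarrow> nat \<Rightarrow> (nat \<Rightarrow> int ^ 'd) \<Rightarrow> real mat \<Rightarrow> ('d::finite) shift_op mat" where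
  "W_mat dx a b q e M =
     map_mat of_real M * T_bar dx a b q e * map_mat of_real (the (mat_inverse M))"

definition A_mat ::
  "real \<Rightarrow> real \<Rightarrow> real \<Rightarrow> nat \<Rightarrow> (nat \<Rightarrow> int ^ 'd) \<Rightarrow> real mat \<Rightarrow> real mat
    \<Rightarrow> ('d::finite) shift_op mat" where
  "A_mat dx a b q e M S = W_mat dx a b q e M * map_mat of_real (1\<^sub>m q - S)"

definition B_mat ::
  "real \<Rightarrow> real \<Rightarrow> real \<Rightarrow> nat \<Rightarrow> (nat \<Rightarrow> int ^ 'd) \<Rightarrow> real mat \<Rightarrow> real mat
    \<Rightarrow> ('d::finite) shift_op mat" where
  "B_mat dx a b q e M S = W_mat dx a b q e M * map_mat of_real S"

end

theory Submission
  imports Defs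
begin

text \<open>
  On the lattice the model reads \<open>u\<^sup>n\<^sup>+\<^sup>1 = A u\<^sup>n + g\<^sup>n\<close>, that is \<open>(T I - A) u = g\<close> with the time
  shift \<open>T\<close>; applying \<open>adj (T I - A)\<close> to both sides gives the determinant form. For the explicit
  scheme, \<open>u\<^sup>n\<^sup>+\<^sup>K = A\<^sup>K u\<^sup>n + \<Sum>\<^sub>k\<^sub><\<^sub>K A\<^sup>k g\<^sup>n\<^sup>+\<^sup>K\<^sup>-\<^sup>1\<^sup>-\<^sup>k\<close> is weighted with the coefficients of the
  characteristic polynomial and summed over \<open>K \<le> q\<close>; by Cayley-Hamilton the terms in \<open>u\<^sup>n\<close> cancel.
\<close>

section \<open>Determinants over a subring\<close>

lemma elements_mat_subset_iff:
  "elements_mat A \<subseteq> R \<longleftrightarrow> (\<forall>i<dim_row A. \<forall>j<dim_col A. A $$ (i, j) \<in> R)"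
  by (force simp: elements_mat_def)

text \<open>A subset rather than a type, since \<open>space_ring dx\<close> and
  \<open>lattice_local dx\<close> depend on the value \<open>dx\<close> while determinants are
  formed in the ambient operator ring. The locale serves both of these and also polynomials with
  coefficients in \<open>R\<close>.\<close>

locale subring_set =
  fixes R :: "'a::comm_ring_1 set"
  assumes one_mem: "1 \<in> R"
    and uminus_mem: "x \<in> R \<Longrightarrow> - x \<in> R"
    and add_mem: "x \<in> R \<Longrightarrow> y \<in> R \<Longrightarrow> x + y \<in> R"
    and mult_mem: "x \<in> R \<Longrightarrow> y \<in> R \<Longrightarrow> x * y \<in> R"
begin

lemma zero_mem: "0 \<in> R"
  using add_mem[OF one_mem uminus_mem[OF one_mem]] by simp

lemma minus_mem: "x \<in> R \<Longrightarrow> y \<in> R \<Longrightarrow> x - y \<in> R"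
  using add_mem[OF _ uminus_mem, of x y] by simp

lemma sum_mem: "(\<And>i. i \<in> I \<Longrightarrow> f i \<in> R) \<Longrightarrow> sum f I \<in> R"
  by (induction I rule: infinite_finite_induct) (auto simp: zero_mem add_mem)

lemma prod_mem: "(\<And>i. i \<in> I \<Longrightarrow> f i \<in> R) \<Longrightarrow> prod f I \<in> R"
  by (induction I rule: infinite_finite_induct) (auto simp: one_mem mult_mem)

lemma power_mem: "x \<in> R \<Longrightarrow> x ^ n \<in> R"
  by (induction n) (auto simp: one_mem mult_mem)

lemma signof_mem: "signof p \<in> R"
  by (auto simp: sign_def one_mem uminus_mem)

lemma det_mem:
  assumes "elements_mat A \<subseteq> R"
  shows "det A \<in> R"
proof -
  have "A $$ (i, p i) \<in> R"
    if "p permutes {0..<dim_row A}" "dim_row A = dim_col A" "i \<in> {0..<dim_row A}" for i p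
    using assms permutes_in_image[OF that(1), of i] that by (auto simp: elements_mat_subset_iff)
  \<comment> \<open>Leibniz formula; \<open>zero_mem\<close> covers the value 0 that
    \<open>det\<close> takes on nonsquare matrices.\<close>
  then show ?thesis
    unfolding det_def by (auto intro!: sum_mem mult_mem prod_mem signof_mem zero_mem)
qed

lemma cofactor_mem:
  assumes "elements_mat A \<subseteq> R"
  shows "cofactor A i j \<in> R"
proof -
  have "elements_mat (mat_delete A i j) \<subseteq> R"
    using assms by (auto simp: elements_mat_subset_iff mat_delete_def)
  then show ?thesis
    unfolding cofactor_def by (intro mult_mem power_mem uminus_mem one_mem det_mem)
qed

lemma adj_mat_mem:
  "elements_mat A \<subseteq> R \<Longrightarrow> elements_mat (adj_mat A) \<subseteq> R"
  by (subst elements_mat_subset_iff) (auto simp: adj_mat_def intro!: cofactor_mem)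

lemma times_mat_mem:
  assumes "elements_mat A \<subseteq> R" "elements_mat B \<subseteq> R" "dim_col A = dim_row B"
  shows "elements_mat (A * B) \<subseteq> R"
  using assms
  by (auto simp: elements_mat_subset_iff scalar_prod_def intro!: sum_mem mult_mem)

lemma plus_mat_mem:
  assumes "elements_mat A \<subseteq> R" "elements_mat B \<subseteq> R" "dim_row A = dim_row B" "dim_col A = dim_col B"
  shows "elements_mat (A + B) \<subseteq> R"
  using assms by (auto simp: elements_mat_subset_iff intro!: add_mem)

lemma minus_mat_mem:
  assumes "elements_mat A \<subseteq> R" "elements_mat B \<subseteq> R" "dim_row A = dim_row B" "dim_col A = dim_col B"
  shows "elements_mat (A - B) \<subseteq> R"
  using assms by (auto simp: elements_mat_subset_iff intro!: minus_mem)

lemma smult_mat_mem: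
  assumes "c \<in> R" "elements_mat A \<subseteq> R"
  shows "elements_mat (c \<cdot>\<^sub>m A) \<subseteq> R"
  using assms by (auto simp: elements_mat_subset_iff intro!: mult_mem)

lemma one_mat_mem: "elements_mat (1\<^sub>m n) \<subseteq> R"
  by (auto simp: elements_mat_subset_iff one_mem zero_mem)

lemma mat_diag_mem: "(\<And>i. f i \<in> R) \<Longrightarrow> elements_mat (mat_diag n f) \<subseteq> R"
  by (auto simp: elements_mat_subset_iff mat_diag_def zero_mem)

lemma pow_mat_mem:
  assumes "A \<in> carrier_mat n n" "elements_mat A \<subseteq> R"
  shows "elements_mat (A ^\<^sub>m k) \<subseteq> R"
  using assms by (induction k) (simp_all add: one_mat_mem times_mat_mem)

text \<open>The characteristic polynomial is a determinant over the polynomial ring, so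
  \<open>det_mem\<close> for this set bounds its coefficients.\<close>

lemma subring_set_poly: "subring_set {p. \<forall>i. coeff p i \<in> R}"
  by unfold_locales
    (auto simp: coeff_mult one_mem zero_mem uminus_mem add_mem coeff_1 intro!: sum_mem mult_mem)

lemma coeff_char_poly_mem:
  assumes "elements_mat A \<subseteq> R" "A \<in> carrier_mat n n"
  shows "coeff (char_poly A) k \<in> R"
proof -
  interpret poly: subring_set "{p. \<forall>i. coeff p i \<in> R}"
    by (rule subring_set_poly)
  have const: "elements_mat (map_mat (\<lambda>a. [:- a:]) A) \<subseteq> {p. \<forall>i. coeff p i \<in> R}"
    using assms(1) by (auto simp: elements_mat_subset_iff coeff_pCons zero_mem uminus_mem split: nat.split)
  have "[:0, 1:] \<in> {p. \<forall>i. coeff p i \<in> R}"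
    by (auto simp: coeff_pCons zero_mem one_mem split: nat.split)
  then have "elements_mat (char_poly_matrix A) \<subseteq> {p. \<forall>i. coeff p i \<in> R}"
    unfolding char_poly_matrix_def using const assms(2)
    by (intro poly.plus_mat_mem poly.smult_mat_mem poly.one_mat_mem) auto
  then show ?thesis
    unfolding char_poly_def using poly.det_mem by auto
qed

end

section \<open>The Cayley-Hamilton theorem\<close>

text \<open>
  The coefficient matrices \<open>B\<^sub>k\<close> of \<open>adj (x I - A)\<close> satisfy \<open>c\<^sub>k I = B\<^sub>k\<^sub>-\<^sub>1 - A B\<^sub>k\<close>, so the sum
  of the \<open>c\<^sub>k A\<^sup>k\<close> telescopes.
\<close>

lemma cayley_hamilton_entry:
  fixes A :: "'a::comm_ring_1 mat"
  assumes A: "A \<in> carrier_mat n n" and i: "i < n" and j: "j < n"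
  shows "(\<Sum>k\<le>n. coeff (char_poly A) k * (A ^\<^sub>m k) $$ (i, j)) = 0"
proof -
  define D where "D = adj_mat (char_poly_matrix A)"
  define c where "c = coeff (char_poly A)"
  \<comment> \<open>\<open>pCons 0\<close> shifts the index by one: \<open>B (Suc k)\<close> holds
    the coefficients of degree \<open>k\<close> of the adjugate and \<open>B 0\<close> is zero, so
    the recursion needs no special case at \<open>k = 0\<close>.\<close>
  define B where "B k = mat n n (\<lambda>(i, j). coeff (pCons 0 (D $$ (i, j))) k)" for k
  have X: "char_poly_matrix A \<in> carrier_mat n n"
    using A by simp
  have D: "D \<in> carrier_mat n n" and XD: "char_poly_matrix A * D = char_poly A \<cdot>\<^sub>m 1\<^sub>m n"
    using adj_mat[OF X] by (auto simp: D_def char_poly_def)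
  have B: "B k \<in> carrier_mat n n" for k
    by (simp add: B_def)
  have step: "c k \<cdot>\<^sub>m 1\<^sub>m n = B k - A * B (Suc k)" for k
  proof (rule eq_matI)
    fix r s
    assume "r < dim_row (B k - A * B (Suc k))" "s < dim_col (B k - A * B (Suc k))"
    then have rs: "r < n" "s < n"
      using A B[of "Suc k"] by auto
    \<comment> \<open>Entry \<open>(r, s)\<close> of \<open>XD\<close>; the diagonal variable of
      \<open>char_poly_matrix A\<close> becomes \<open>pCons 0\<close>, and coefficients of degree
      \<open>k\<close> are compared at the end.\<close>
    have "char_poly A * (if r = s then 1 else 0) = (char_poly_matrix A * D) $$ (r, s)"
      using rs by (simp add: XD)
    also have "\<dots> = (\<Sum>l<n. char_poly_matrix A $$ (r, l) * D $$ (l, s))"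
      using rs X D by (simp add: scalar_prod_def atLeast0LessThan)
    also have "\<dots> = (\<Sum>l<n. (if l = r then pCons 0 (D $$ (l, s)) else 0)
        - Polynomial.smult (A $$ (r, l)) (D $$ (l, s)))"
      using rs A by (intro sum.cong) (auto simp: char_poly_matrix_def)
    also have "\<dots> = pCons 0 (D $$ (r, s)) - (\<Sum>l<n. Polynomial.smult (A $$ (r, l)) (D $$ (l, s)))"
      using rs by (simp add: sum_subtractf)
    finally have "coeff (char_poly A * (if r = s then 1 else 0)) k
        = coeff (pCons 0 (D $$ (r, s)) - (\<Sum>l<n. Polynomial.smult (A $$ (r, l)) (D $$ (l, s)))) k"
      by simp
    then show "(c k \<cdot>\<^sub>m 1\<^sub>m n) $$ (r, s) = (B k - A * B (Suc k)) $$ (r, s)"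
      using rs A by (simp add: B_def c_def coeff_sum scalar_prod_def atLeast0LessThan split: if_splits)
  qed (use A B[of "Suc k"] in auto)
  have telescope: "c k * (A ^\<^sub>m k) $$ (i, j)
      = (A ^\<^sub>m k * B k) $$ (i, j) - (A ^\<^sub>m Suc k * B (Suc k)) $$ (i, j)" for k
  proof -
    have Ak: "A ^\<^sub>m k \<in> carrier_mat n n"
      using A by simp
    have "A ^\<^sub>m k * (c k \<cdot>\<^sub>m 1\<^sub>m n) = c k \<cdot>\<^sub>m A ^\<^sub>m k"
      by (simp add: mult_smult_distrib[OF Ak one_carrier_mat] right_mult_one_mat[OF Ak])
    moreover have "A ^\<^sub>m k * (B k - A * B (Suc k)) = A ^\<^sub>m k * B k - A ^\<^sub>m Suc k * B (Suc k)"
      by (simp add: mult_minus_distrib_mat[OF Ak B mult_carrier_mat[OF A B]] assoc_mult_mat[OF Ak A B])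
    ultimately have "c k \<cdot>\<^sub>m A ^\<^sub>m k = A ^\<^sub>m k * B k - A ^\<^sub>m Suc k * B (Suc k)"
      by (simp only: step)
    then have "(c k \<cdot>\<^sub>m A ^\<^sub>m k) $$ (i, j) = (A ^\<^sub>m k * B k - A ^\<^sub>m Suc k * B (Suc k)) $$ (i, j)"
      by (rule arg_cong)
    then show ?thesis
      using i j A B[of "Suc k"] by simp
  qed
  \<comment> \<open>Large enough to exceed neither degree bound: every entry of \<open>D\<close> has
    degree at most \<open>N\<close>, so the last telescoped term vanishes, and \<open>n\<close> is
    at most \<open>N\<close>, so only zero coefficients are added to the sum.\<close>
  define N where "N = n + (\<Sum>(r, s)\<in>{..<n} \<times> {..<n}. degree (D $$ (r, s)))"
  have "B (Suc (Suc N)) = 0\<^sub>m n n"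
  proof (rule eq_matI)
    fix r s
    assume rs: "r < dim_row (0\<^sub>m n n :: 'a mat)" "s < dim_col (0\<^sub>m n n :: 'a mat)"
    then have "(case (r, s) of (r, s) \<Rightarrow> degree (D $$ (r, s)))
        \<le> (\<Sum>(r, s)\<in>{..<n} \<times> {..<n}. degree (D $$ (r, s)))"
      by (intro member_le_sum) auto
    then have "degree (D $$ (r, s)) < Suc N"
      by (simp add: N_def)
    then show "B (Suc (Suc N)) $$ (r, s) = 0\<^sub>m n n $$ (r, s)"
      using rs by (simp add: B_def coeff_eq_0)
  qed (auto simp: B_def)
  moreover have "B 0 = 0\<^sub>m n n"
    by (auto simp: B_def)
  moreover have "A ^\<^sub>m Suc (Suc N) * 0\<^sub>m n n = 0\<^sub>m n n" "A ^\<^sub>m 0 * 0\<^sub>m n n = 0\<^sub>m n n"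
    using A by (intro right_mult_zero_mat pow_carrier_mat; simp)+
  moreover have "(\<Sum>k\<le>Suc N. c k * (A ^\<^sub>m k) $$ (i, j))
      = (A ^\<^sub>m 0 * B 0) $$ (i, j) - (A ^\<^sub>m Suc (Suc N) * B (Suc (Suc N))) $$ (i, j)"
    unfolding telescope by (rule sum_telescope)
  ultimately have "(\<Sum>k\<le>Suc N. c k * (A ^\<^sub>m k) $$ (i, j)) = 0"
    using i j by (simp only: diff_zero index_zero_mat)
  moreover have "(\<Sum>k\<le>n. c k * (A ^\<^sub>m k) $$ (i, j)) = (\<Sum>k\<le>Suc N. c k * (A ^\<^sub>m k) $$ (i, j))"
    using degree_monic_char_poly[OF A]
    by (intro sum.mono_neutral_left) (auto simp: N_def c_def coeff_eq_0)
  ultimately show ?thesis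
    by (simp add: c_def)
qed

section \<open>Locality of the space-time operators\<close>

lemma op_app_zero [simp]: "op_app 0 h n x = 0"
  by transfer simp

lemma op_app_one [simp]: "op_app 1 h = h"
  by transfer simp

lemma op_app_add: "op_app (P + Q) h n x = op_app P h n x + op_app Q h n x"
  by transfer simp

lemma op_app_uminus: "op_app (- P) h n x = - op_app P h n x"
  by transfer simp

lemma op_app_minus: "op_app (P - Q) h n x = op_app P h n x - op_app Q h n x"
  by transfer simp

lemma op_app_mult: "op_app (P * Q) h = op_app P (op_app Q h)"
  by transfer simp

lemma op_app_sum: "op_app (sum P I) h n x = (\<Sum>i\<in>I. op_app (P i) h n x)"
  by (induction I rule: infinite_finite_induct) (auto simp: op_app_add)

lemma op_app_add_arg:
  "op_app P (\<lambda>n x. h n x + k n x) n x = op_app P h n x + op_app P k n x"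
  by transfer (simp add: shift_algebra_add_arg)

lemma op_app_zero_arg: "op_app P (\<lambda>n x. 0) n x = 0"
  using op_app_add_arg[of P "\<lambda>n x. 0" "\<lambda>n x. 0" n x] by simp

lemma op_app_sum_arg:
  "op_app P (\<lambda>n x. \<Sum>i\<in>I. h i n x) n x = (\<Sum>i\<in>I. op_app P (h i) n x)"
  by (induction I rule: infinite_finite_induct) (auto simp: op_app_zero_arg op_app_add_arg)

lemma op_app_Suc_arg: "op_app P (\<lambda>n x. h (Suc n) x) n x = op_app P h (Suc n) x"
  by transfer (simp add: shift_algebra_commute_time)

lemma op_app_time_shift: "op_app time_shift h n x = h (Suc n) x"
  by transfer simp

lemma op_app_space_shift: "op_app (space_shift dx z) h n x = h n (x + lattice_vec dx z)"
  by transfer simp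

lemma op_app_of_real: "op_app (of_real c) h n x = c * h n x"
  unfolding of_real_def by transfer simp

text \<open>
  The model equation holds on the lattice only, so an operator may be applied to both of its sides
  only if its values on the lattice do not depend on values off the lattice.
\<close>

definition lattice_local :: "real \<Rightarrow> ('d::finite) shift_op set" where
  "lattice_local dx = {P. \<forall>h k. (\<forall>n. \<forall>x\<in>space_lattice dx. h n x = k n x)
     \<longrightarrow> (\<forall>n. \<forall>x\<in>space_lattice dx. op_app P h n x = op_app P k n x)}"

lemma lattice_localI:
  assumes "\<And>h k n x. (\<And>n x. x \<in> space_lattice dx \<Longrightarrow> h n x = k n x) \<Longrightarrow> x \<in> space_lattice dx
    \<Longrightarrow> op_app P h n x = op_app P k n x"
  shows "P \<in> lattice_local dx"
  using assms unfolding lattice_local_def by blast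

lemma lattice_localD:
  assumes "P \<in> lattice_local dx" "\<And>n x. x \<in> space_lattice dx \<Longrightarrow> h n x = k n x" "x \<in> space_lattice dx"
  shows "op_app P h n x = op_app P k n x"
  using assms unfolding lattice_local_def by blast

lemma space_lattice_shift:
  assumes "x \<in> space_lattice dx"
  shows "x + lattice_vec dx z \<in> space_lattice dx"
proof -
  obtain y where "x = lattice_vec dx y"
    using assms by (auto simp: space_lattice_def)
  then have "x + lattice_vec dx z = lattice_vec dx (y + z)"
    by (simp add: lattice_vec_def Finite_Cartesian_Product.vec_eq_iff distrib_left)
  then show ?thesis
    by (simp add: space_lattice_def)
qed

text \<open>Locality passes to sums and products, hence to adjugates, matrix powers and
  characteristic coefficients of matrices with local entries.\<close>

interpretation lattice_local: subring_set "lattice_local dx" for dx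
proof
  show "1 \<in> lattice_local dx"
    by (rule lattice_localI) simp
  fix P Q :: "'a shift_op"
  assume P: "P \<in> lattice_local dx"
  show "- P \<in> lattice_local dx"
  proof (rule lattice_localI)
    fix h k :: "'a field_seq" and n and x :: "real ^ 'a"
    assume "\<And>n x. x \<in> space_lattice dx \<Longrightarrow> h n x = k n x" "x \<in> space_lattice dx"
    then show "op_app (- P) h n x = op_app (- P) k n x"
      unfolding op_app_uminus using lattice_localD[OF P, of h k] by simp
  qed
  assume Q: "Q \<in> lattice_local dx"
  show "P + Q \<in> lattice_local dx"
  proof (rule lattice_localI)
    fix h k :: "'a field_seq" and n and x :: "real ^ 'a"
    assume "\<And>n x. x \<in> space_lattice dx \<Longrightarrow> h n x = k n x" "x \<in> space_lattice dx"
    then show "op_app (P + Q) h n x = op_app (P + Q) k n x"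
      unfolding op_app_add using lattice_localD[OF P, of h k] lattice_localD[OF Q, of h k] by simp
  qed
  show "P * Q \<in> lattice_local dx"
  proof (rule lattice_localI)
    fix h k :: "'a field_seq" and n and x :: "real ^ 'a"
    assume "\<And>n x. x \<in> space_lattice dx \<Longrightarrow> h n x = k n x" "x \<in> space_lattice dx"
    then show "op_app (P * Q) h n x = op_app (P * Q) k n x"
      unfolding op_app_mult by (intro lattice_localD[OF P] lattice_localD[OF Q])
  qed
qed

lemma time_shift_lattice_local: "time_shift \<in> lattice_local dx"
  by (rule lattice_localI) (simp add: op_app_time_shift)

text \<open>The generators are local because shifts of spacing \<open>dx\<close> map the lattice
  into itself.\<close>

lemma space_ring_lattice_local: "P \<in> space_ring dx \<Longrightarrow> P \<in> lattice_local dx"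
proof (induction rule: space_ring.induct)
  case (const c)
  show ?case by (rule lattice_localI) (simp add: op_app_of_real)
next
  case (shift z)
  show ?case by (rule lattice_localI) (simp add: op_app_space_shift space_lattice_shift)
qed (auto intro: lattice_local.add_mem lattice_local.mult_mem)

interpretation space_ring: subring_set "space_ring dx" for dx
proof
  \<comment> \<open>Neither the unit nor negation is a generating rule; both come from real
    constants.\<close>
  show "1 \<in> space_ring dx"
    using space_ring.const[of 1] by simp
  show "- P \<in> space_ring dx" if "P \<in> space_ring dx" for P :: "'a shift_op"
    using space_ring.mult[OF space_ring.const[of "-1"] that] by simp
qed (auto intro: space_ring.add space_ring.mult)

section \<open>Operator matrices\<close>

lemma mat_app_index:
  "i < dim_row P \<Longrightarrow> mat_app P u n x $ i = (\<Sum>j<dim_col P. op_app (P $$ (i, j)) (component u j) n x)"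
  by (simp add: mat_app_def)

lemma dim_mat_app [simp]: "dim_vec (mat_app P u n x) = dim_row P"
  by (simp add: mat_app_def)

lemma component_mat_app:
  "i < dim_row P \<Longrightarrow>
    component (mat_app P u) i = (\<lambda>n x. \<Sum>j<dim_col P. op_app (P $$ (i, j)) (component u j) n x)"
  by (simp add: component_def mat_app_index)

lemma mat_app_mult:
  assumes "P \<in> carrier_mat r s" "Q \<in> carrier_mat s t"
  shows "mat_app (P * Q) u n x = mat_app P (mat_app Q u) n x"
proof (rule eq_vecI)
  fix i
  assume "i < dim_vec (mat_app P (mat_app Q u) n x)"
  then have i: "i < r"
    using assms by simp
  have "mat_app (P * Q) u n x $ i
      = (\<Sum>j<t. \<Sum>k<s. op_app (P $$ (i, k)) (op_app (Q $$ (k, j)) (component u j)) n x)"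
    using assms i
    by (simp add: mat_app_index scalar_prod_def op_app_sum op_app_mult atLeast0LessThan)
  also have "\<dots> = (\<Sum>k<s. \<Sum>j<t. op_app (P $$ (i, k)) (op_app (Q $$ (k, j)) (component u j)) n x)"
    by (rule sum.swap)
  also have "\<dots> = mat_app P (mat_app Q u) n x $ i"
    using assms i by (simp add: mat_app_index component_mat_app op_app_sum_arg)
  finally show "mat_app (P * Q) u n x $ i = mat_app P (mat_app Q u) n x $ i" .
qed (use assms in simp)

text \<open>Turns a scalar operator on one component into a matrix action, as needed for the
  determinant times the identity and for zero time steps.\<close>

lemma mat_app_smult_one:
  assumes "i < q"
  shows "mat_app (p \<cdot>\<^sub>m 1\<^sub>m q) u n x $ i = op_app p (component u i) n x"
proof -
  have "mat_app (p \<cdot>\<^sub>m 1\<^sub>m q) u n x $ i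
      = (\<Sum>j<q. op_app (p * (if i = j then 1 else 0)) (component u j) n x)"
    using assms by (simp add: mat_app_index)
  also have "\<dots> = (\<Sum>j<q. if j = i then op_app p (component u i) n x else 0)"
    by (rule sum.cong) auto
  finally show ?thesis
    using assms by simp
qed

lemma mat_app_minus:
  assumes "P \<in> carrier_mat r s" "Q \<in> carrier_mat r s"
  shows "mat_app (P - Q) u n x = mat_app P u n x - mat_app Q u n x"
  using assms by (auto simp: mat_app_def op_app_minus sum_subtractf)

text \<open>A vector sum takes its dimension from the second summand, hence the condition on
  \<open>v\<close>.\<close>

lemma mat_app_add_arg:
  assumes "\<And>n x. dim_vec (v n x) = dim_col P"
  shows "mat_app P (\<lambda>n x. u n x + v n x) n x = mat_app P u n x + mat_app P v n x"
  by (auto simp: mat_app_def component_def assms op_app_add_arg sum.distrib)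

text \<open>All operators commute with the time shift. This exposes \<open>u (Suc n)\<close> as an
  argument in which the recurrence can be substituted.\<close>

lemma mat_app_Suc_arg: "mat_app P (\<lambda>n. u (Suc n)) n x = mat_app P u (Suc n) x"
proof -
  have "component (\<lambda>n. u (Suc n)) j = (\<lambda>n x. component u j (Suc n) x)" for j
    by (simp add: component_def)
  then show ?thesis
    by (simp only: mat_app_def op_app_Suc_arg)
qed

text \<open>The substitution rule for equations known on the lattice only.\<close>

lemma mat_app_lattice_cong:
  assumes "elements_mat P \<subseteq> lattice_local dx" "x \<in> space_lattice dx"
    and "\<And>n x. x \<in> space_lattice dx \<Longrightarrow> u n x = v n x"
  shows "mat_app P u n x = mat_app P v n x"
proof -
  have "op_app (P $$ (i, j)) (component u j) n x = op_app (P $$ (i, j)) (component v j) n x"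
    if "i < dim_row P" "j < dim_col P" for i j
  proof (rule lattice_localD)
    show "P $$ (i, j) \<in> lattice_local dx"
      using assms(1) that by (auto simp: elements_mat_subset_iff)
  qed (use assms in \<open>auto simp: component_def\<close>)
  then show ?thesis
    by (intro eq_vecI) (simp_all add: mat_app_index)
qed

section \<open>Elimination of the nonconserved components\<close>

text \<open>\<open>K\<close> steps of the recurrence with weight \<open>p\<close>. The weight is
  placed inside the matrices so that each step is a substitution under a local operator
  matrix.\<close>

lemma op_app_component_advance:
  assumes A: "A \<in> carrier_mat q q" "elements_mat A \<subseteq> lattice_local dx"
    and p: "p \<in> lattice_local dx"
    and i: "i < q"
    and g: "\<And>n x. dim_vec (g n x) = q"
    and step: "\<And>n x. x \<in> space_lattice dx \<Longrightarrow> u (Suc n) x = mat_app A u n x + g n x"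
    and x: "x \<in> space_lattice dx"
  shows "op_app p (component u i) (n + K) x
    = mat_app (p \<cdot>\<^sub>m A ^\<^sub>m K) u n x $ i + (\<Sum>k<K. mat_app (p \<cdot>\<^sub>m A ^\<^sub>m k) g (n + K - 1 - k) x $ i)"
proof (induction K arbitrary: n)
  case 0
  show ?case
    using A i by (simp add: mat_app_smult_one)
next
  case (Suc K)
  have P: "p \<cdot>\<^sub>m A ^\<^sub>m K \<in> carrier_mat q q"
    using A by simp
  have local: "elements_mat (p \<cdot>\<^sub>m A ^\<^sub>m K) \<subseteq> lattice_local dx"
    by (intro lattice_local.smult_mat_mem lattice_local.pow_mat_mem[of _ q] A p)
  have "mat_app (p \<cdot>\<^sub>m A ^\<^sub>m K) u (Suc n) x = mat_app (p \<cdot>\<^sub>m A ^\<^sub>m K) (\<lambda>n. u (Suc n)) n x"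
    by (simp add: mat_app_Suc_arg)
  also have "\<dots> = mat_app (p \<cdot>\<^sub>m A ^\<^sub>m K) (\<lambda>n x. mat_app A u n x + g n x) n x"
    by (rule mat_app_lattice_cong[OF local x]) (rule step)
  also have "\<dots> = mat_app (p \<cdot>\<^sub>m A ^\<^sub>m K) (mat_app A u) n x + mat_app (p \<cdot>\<^sub>m A ^\<^sub>m K) g n x"
    by (intro mat_app_add_arg) (simp add: g carrier_matD(2)[OF P] del: index_smult_mat)
  also have "mat_app (p \<cdot>\<^sub>m A ^\<^sub>m K) (mat_app A u) n x = mat_app (p \<cdot>\<^sub>m A ^\<^sub>m Suc K) u n x"
    by (simp add: mat_app_mult[OF P A(1), symmetric]
        mult_smult_assoc_mat[OF pow_carrier_mat[OF A(1)] A(1)])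
  finally have "mat_app (p \<cdot>\<^sub>m A ^\<^sub>m K) u (Suc n) x $ i
      = mat_app (p \<cdot>\<^sub>m A ^\<^sub>m Suc K) u n x $ i + mat_app (p \<cdot>\<^sub>m A ^\<^sub>m K) g n x $ i"
    using A i by simp
  \<comment> \<open>The induction hypothesis starts at \<open>Suc n\<close>; rewriting its leading
    term adds the summand \<open>k = K\<close>, with \<open>g\<close> taken at time
    \<open>n\<close>.\<close>
  then show ?case
    using Suc.IH[of "Suc n"] by simp
qed

lemma op_app_det_component:
  assumes A: "A \<in> carrier_mat q q" "elements_mat A \<subseteq> lattice_local dx"
    and i: "i < q"
    and u: "\<And>n x. x \<in> space_lattice dx \<Longrightarrow> dim_vec (u n x) = q"
    and g: "\<And>n x. dim_vec (g n x) = q"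
    and step: "\<And>n x. x \<in> space_lattice dx \<Longrightarrow> u (Suc n) x = mat_app A u n x + g n x"
    and x: "x \<in> space_lattice dx"
  shows "op_app (det (time_shift \<cdot>\<^sub>m 1\<^sub>m q - A)) (component u i) n x
    = mat_app (adj_mat (time_shift \<cdot>\<^sub>m 1\<^sub>m q - A)) g n x $ i"
proof -
  define D where "D = time_shift \<cdot>\<^sub>m 1\<^sub>m q - A"
  have D: "D \<in> carrier_mat q q"
    using A by (simp add: D_def minus_carrier_mat)
  have "elements_mat D \<subseteq> lattice_local dx"
    unfolding D_def using A
    by (intro lattice_local.minus_mat_mem lattice_local.smult_mat_mem time_shift_lattice_local
        lattice_local.one_mat_mem) auto
  \<comment> \<open>\<open>adj_mat D\<close> is about to be applied to an equation that holds on the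
    lattice only.\<close>
  then have local: "elements_mat (adj_mat D) \<subseteq> lattice_local dx"
    by (rule lattice_local.adj_mat_mem)
  have Du: "mat_app D u n x = g n x" if "x \<in> space_lattice dx" for n x
  proof (rule eq_vecI)
    fix j
    assume "j < dim_vec (g n x)"
    then have j: "j < q"
      by (simp add: g)
    have "mat_app D u n x $ j = u (Suc n) x $ j - mat_app A u n x $ j"
      unfolding D_def using A j
      by (simp add: mat_app_minus[of _ q q] mat_app_smult_one op_app_time_shift component_def)
    then show "mat_app D u n x $ j = g n x $ j"
      using A j by (simp add: step[OF that] g)
  qed (use D g in auto)
  have "op_app (det D) (component u i) n x = mat_app (adj_mat D * D) u n x $ i"
    using i by (simp add: adj_mat(3)[OF D] mat_app_smult_one)
  also have "\<dots> = mat_app (adj_mat D) (mat_app D u) n x $ i"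
    using mat_app_mult[OF adj_mat(1)[OF D] D] by simp
  also have "\<dots> = mat_app (adj_mat D) g n x $ i"
    using mat_app_lattice_cong[OF local x, of "mat_app D u" g] Du by simp
  finally show ?thesis
    by (simp only: D_def)
qed

text \<open>The scheme before reindexing: \<open>K\<close> is the level above \<open>n\<close>,
  \<open>k\<close> the power of \<open>A\<close>, and \<open>g\<close> is read \<open>k + 1\<close>
  levels below \<open>n + K\<close>.\<close>

lemma char_poly_component:
  assumes A: "A \<in> carrier_mat q q" "elements_mat A \<subseteq> lattice_local dx"
    and i: "i < q"
    and g: "\<And>n x. dim_vec (g n x) = q"
    and step: "\<And>n x. x \<in> space_lattice dx \<Longrightarrow> u (Suc n) x = mat_app A u n x + g n x"
    and x: "x \<in> space_lattice dx"
  shows "(\<Sum>K\<le>q. op_app (coeff (char_poly A) K) (component u i) (n + K) x)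
    = (\<Sum>K\<le>q. \<Sum>k<K. mat_app (coeff (char_poly A) K \<cdot>\<^sub>m A ^\<^sub>m k) g (n + K - 1 - k) x $ i)"
proof -
  define c where "c = coeff (char_poly A)"
  have "c K \<in> lattice_local dx" for K
    unfolding c_def using A by (intro lattice_local.coeff_char_poly_mem)
  then have "op_app (c K) (component u i) (n + K) x
    = mat_app (c K \<cdot>\<^sub>m A ^\<^sub>m K) u n x $ i
      + (\<Sum>k<K. mat_app (c K \<cdot>\<^sub>m A ^\<^sub>m k) g (n + K - 1 - k) x $ i)" for K
    by (intro op_app_component_advance[OF A _ i g step x])
  \<comment> \<open>After exchanging the sums, row \<open>i\<close> of the Cayley-Hamilton identity
    annihilates each component of \<open>u n\<close>.\<close>
  moreover have "(\<Sum>K\<le>q. mat_app (c K \<cdot>\<^sub>m A ^\<^sub>m K) u n x $ i) = 0"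
  proof -
    have "(\<Sum>K\<le>q. mat_app (c K \<cdot>\<^sub>m A ^\<^sub>m K) u n x $ i)
        = (\<Sum>K\<le>q. \<Sum>j<q. op_app (c K * (A ^\<^sub>m K) $$ (i, j)) (component u j) n x)"
      using A(1) i by (intro sum.cong) (auto simp: mat_app_index pow_mat_dim_square[OF A(1)] simp del: pow_mat_dim)
    also have "\<dots> = (\<Sum>j<q. op_app (\<Sum>K\<le>q. c K * (A ^\<^sub>m K) $$ (i, j)) (component u j) n x)"
      unfolding op_app_sum by (rule sum.swap)
    also have "\<dots> = 0"
      using cayley_hamilton_entry[OF A(1) i] by (simp add: c_def)
    finally show ?thesis .
  qed
  ultimately show ?thesis
    by (simp add: sum.distrib flip: c_def)
qed

section \<open>The finite-difference scheme\<close>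

text \<open>\<open>mat_inverse\<close> returns \<open>None\<close> only for nonunits of the matrix
  ring, so the unspecified value \<open>the None\<close> is excluded.\<close>

lemma invertible_mat_inverse_carrier:
  fixes M :: "'a::field mat"
  assumes M: "M \<in> carrier_mat q q" "invertible_mat M"
  shows "the (mat_inverse M) \<in> carrier_mat q q"
proof (cases "mat_inverse M")
  case None
  obtain N where N: "M * N = 1\<^sub>m q" "N * M = 1\<^sub>m (dim_row N)"
    using M by (auto simp: invertible_mat_def inverts_mat_def)
  \<comment> \<open>The inverse from \<open>invertible_mat\<close> comes without a shape; the column
    counts of both products force it to be \<open>q\<close> by \<open>q\<close>.\<close>
  have "dim_col (M * N) = q" "dim_col (N * M) = dim_row N"
    using N by simp_all
  then have "N \<in> carrier_mat q q"
    using M by auto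
  then have "M \<in> Units (ring_mat TYPE('a) q ())"
    using M N by (auto simp: Units_def ring_mat_def)
  then show ?thesis
    using mat_inverse(1)[OF M(1) None, of "()"] by blast
next
  case (Some N)
  then show ?thesis
    using mat_inverse(2)[OF M(1) Some] by simp
qed

lemma of_real_mat_space_ring: "elements_mat (map_mat of_real N) \<subseteq> space_ring dx"
  by (auto simp: elements_mat_subset_iff space_ring.const)

lemma W_mat_carrier:
  assumes "M \<in> carrier_mat q q" "invertible_mat M"
  shows "W_mat dx a b q e M \<in> carrier_mat q q"
  using assms invertible_mat_inverse_carrier[OF assms]
  by (auto simp: W_mat_def)

lemma W_mat_space_ring:
  assumes "M \<in> carrier_mat q q" "invertible_mat M"
  shows "elements_mat (W_mat dx a b q e M) \<subseteq> space_ring dx"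
proof -
  have "elements_mat (T_bar dx a b q e) \<subseteq> space_ring dx"
    unfolding T_bar_def
    by (intro space_ring.plus_mat_mem space_ring.smult_mat_mem space_ring.one_mat_mem
        space_ring.mat_diag_mem space_ring.const space_ring.shift) (auto simp: mat_diag_def)
  then show ?thesis
    unfolding W_mat_def using assms invertible_mat_inverse_carrier[OF assms]
    by (intro space_ring.times_mat_mem of_real_mat_space_ring) (auto simp: T_bar_def mat_diag_def)
qed

text \<open>Index 0 is the conserved moment, and \<open>g\<close> collects the equilibrium and
  source terms. As \<open>\<gamma>\<close> is given by a polynomial identity, its membership in the
  space ring and its leading value are part of the conclusion.\<close>

theorem proposition1:
  fixes dx dt a b :: real
    and q :: nat
    and e :: "nat \<Rightarrow> int ^ 'd::finite"
    and M S :: "real mat"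
    and W A B :: "'d shift_op mat"
    and m meq F g :: "'d vec_seq"
    and \<gamma> :: "nat \<Rightarrow> 'd shift_op"
  assumes d: "CARD('d) \<in> {1, 2, 3}"
    and q: "q \<ge> 1"
    and dx: "dx > 0" and dt: "dt > 0"
    and a: "0 < a" "a \<le> 1" and b: "a\<^sup>2 \<le> b" "b \<le> 1"
    and M: "M \<in> carrier_mat q q" "invertible_mat M"
    and S: "S \<in> carrier_mat q q" "invertible_mat S"
    and W_eq: "W = W_mat dx a b q e M"
    and A_eq: "A = A_mat dx a b q e M S"
    and B_eq: "B = B_mat dx a b q e M S"
    and m_dim: "\<And>n x. x \<in> space_lattice dx \<Longrightarrow> m n x \<in> carrier_vec q"
    and meq_dim: "\<And>n x. x \<in> space_lattice dx \<Longrightarrow> meq n x \<in> carrier_vec q"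
    and F_dim: "\<And>n x. x \<in> space_lattice dx \<Longrightarrow> F n x \<in> carrier_vec q"
    and conservative: "\<And>n x. x \<in> space_lattice dx \<Longrightarrow> meq n x $ 0 = m n x $ 0"
    and g_eq: "g = (\<lambda>n x. mat_app B meq n x + dt \<cdot>\<^sub>v mat_app W F n x)"
    and model: "\<And>n x. x \<in> space_lattice dx \<Longrightarrow>
      m (n + 1) x = mat_app A m n x + mat_app B meq n x + dt \<cdot>\<^sub>v mat_app W F n x"
    and \<gamma>: "char_poly A = (\<Sum>k=1..q+1. monom (\<gamma> k) (k - 1))"
  shows "(\<forall>k\<in>{1..q+1}. \<gamma> k \<in> space_ring dx) \<and> \<gamma> (q + 1) = 1
    \<and> (\<forall>n\<ge>q - 1. \<forall>x\<in>space_lattice dx.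
      m (n + 1) x $ 0 =
        - (\<Sum>k=1..q. op_app (\<gamma> k) (component m 0) (n + k - q) x)
        + (\<Sum>k=1..q. \<Sum>l=1..k.
            mat_app (\<gamma> (q + 1 + l - k) \<cdot>\<^sub>m A ^\<^sub>m (l - 1)) g (n + 1 - k) x $ 0))
    \<and> (\<forall>n. \<forall>x\<in>space_lattice dx.
      op_app (det (time_shift \<cdot>\<^sub>m 1\<^sub>m q - A)) (component m 0) n x =
        mat_app (adj_mat (time_shift \<cdot>\<^sub>m 1\<^sub>m q - A)) g n x $ 0)"
proof -
  have W: "W \<in> carrier_mat q q"
    unfolding W_eq using M by (rule W_mat_carrier)
  have A: "A \<in> carrier_mat q q" and B: "B \<in> carrier_mat q q"
    using W S unfolding A_eq B_eq A_mat_def B_mat_def W_eq by auto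
  have A_ring: "elements_mat A \<subseteq> space_ring dx"
    unfolding A_eq A_mat_def using W[unfolded W_eq] S
    by (intro space_ring.times_mat_mem W_mat_space_ring[OF M] of_real_mat_space_ring) auto
  then have A_local: "elements_mat A \<subseteq> lattice_local dx"
    using space_ring_lattice_local by blast
  \<comment> \<open>Valid off the lattice too, because \<open>mat_app\<close> takes its dimension
    from the operator matrix.\<close>
  have g_dim: "dim_vec (g n x) = q" for n x
    using W B by (simp add: g_eq)
  have step: "m (Suc n) x = mat_app A m n x + g n x" if "x \<in> space_lattice dx" for n x
  proof -
    have "mat_app A m n x + mat_app B meq n x + dt \<cdot>\<^sub>v mat_app W F n x = mat_app A m n x + g n x"
      unfolding g_eq using A B W by (intro assoc_add_vec[of _ q] carrier_vecI) auto
    then show ?thesis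
      using model[OF that, of n] by simp
  qed
  \<comment> \<open>The index of \<open>\<gamma>\<close> is one above the exponent.\<close>
  have \<gamma>_coeff: "\<gamma> (Suc K) = coeff (char_poly A) K" if "K \<le> q" for K
  proof -
    have "coeff (char_poly A) K = (\<Sum>k=1..q+1. if k = Suc K then \<gamma> k else 0)"
      unfolding \<gamma> coeff_sum by (intro sum.cong) auto
    then show ?thesis
      using that by simp
  qed
  have \<gamma>_ring: "\<gamma> k \<in> space_ring dx" if k: "k \<in> {1..q+1}" for k
    using \<gamma>_coeff[of "k - 1"] k space_ring.coeff_char_poly_mem[OF A_ring A, of "k - 1"] by auto
  have \<gamma>_top: "\<gamma> (q + 1) = 1"
    using \<gamma>_coeff[of q] degree_monic_char_poly[OF A] by simp
  have scheme: "m (n + 1) x $ 0 =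
        - (\<Sum>k=1..q. op_app (\<gamma> k) (component m 0) (n + k - q) x)
        + (\<Sum>k=1..q. \<Sum>l=1..k.
            mat_app (\<gamma> (q + 1 + l - k) \<cdot>\<^sub>m A ^\<^sub>m (l - 1)) g (n + 1 - k) x $ 0)"
    if n: "n \<ge> q - 1" and x: "x \<in> space_lattice dx" for n x
  proof -
    \<comment> \<open>The oldest time level of the scheme; \<open>n \<ge> q - 1\<close> makes the
      subtraction exact.\<close>
    define r where "r = n + 1 - q"
    have nr: "n + 1 = r + q"
      using n q by (simp add: r_def)
    have "(\<Sum>K\<le>q. op_app (\<gamma> (Suc K)) (component m 0) (r + K) x)
        = (\<Sum>K\<le>q. \<Sum>k<K. mat_app (\<gamma> (Suc K) \<cdot>\<^sub>m A ^\<^sub>m k) g (r + K - 1 - k) x $ 0)"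
      using char_poly_component[OF A A_local _ g_dim step x, of 0 r] q by (simp add: \<gamma>_coeff)
    also have "\<dots> = (\<Sum>(K, k)\<in>(SIGMA K:{..q}. {..<K}).
        mat_app (\<gamma> (Suc K) \<cdot>\<^sub>m A ^\<^sub>m k) g (r + K - 1 - k) x $ 0)"
      by (rule sum.Sigma) auto
    \<comment> \<open>The new \<open>k\<close> counts levels back from \<open>n + 1\<close>, with
      \<open>q + Suc k - K\<close> in the old indices, and \<open>l = Suc k\<close> is one above the
      power of \<open>A\<close>. The bounds \<open>K \<le> q\<close> and \<open>k < K\<close> keep
      all natural subtractions exact.\<close>
    also have "\<dots> = (\<Sum>(k, l)\<in>(SIGMA k:{1..q}. {1..k}).
        mat_app (\<gamma> (q + 1 + l - k) \<cdot>\<^sub>m A ^\<^sub>m (l - 1)) g (n + 1 - k) x $ 0)"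
    proof (rule sum.reindex_bij_witness[where i = "\<lambda>(k, l). (q + l - k, l - 1)"
          and j = "\<lambda>(K, k). (q + Suc k - K, Suc k)"])
      fix z
      assume "z \<in> (SIGMA K:{..q}. {..<K})"
      then obtain K k where z: "z = (K, k)" "K \<le> q" "k < K"
        by auto
      then have "q + 1 + Suc k - (q + Suc k - K) = Suc K" "n + 1 - (q + Suc k - K) = r + K - 1 - k"
        using nr by auto
      then show "(case (case z of (K, k) \<Rightarrow> (q + Suc k - K, Suc k)) of (k, l) \<Rightarrow>
            mat_app (\<gamma> (q + 1 + l - k) \<cdot>\<^sub>m A ^\<^sub>m (l - 1)) g (n + 1 - k) x $ 0)
          = (case z of (K, k) \<Rightarrow> mat_app (\<gamma> (Suc K) \<cdot>\<^sub>m A ^\<^sub>m k) g (r + K - 1 - k) x $ 0)"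
        using z by simp
    qed auto
    also have "\<dots> = (\<Sum>k=1..q. \<Sum>l=1..k.
        mat_app (\<gamma> (q + 1 + l - k) \<cdot>\<^sub>m A ^\<^sub>m (l - 1)) g (n + 1 - k) x $ 0)"
      by (rule sum.Sigma[symmetric]) auto
    finally have sum_eq: "(\<Sum>K\<le>q. op_app (\<gamma> (Suc K)) (component m 0) (r + K) x) = \<dots>" .
    \<comment> \<open>The top level \<open>K = q\<close> has coefficient 1 and time
      \<open>n + 1\<close>: it is the new value, and the other levels move to the right-hand
      side.\<close>
    have "(\<Sum>K\<le>q. op_app (\<gamma> (Suc K)) (component m 0) (r + K) x)
        = (\<Sum>K<q. op_app (\<gamma> (Suc K)) (component m 0) (r + K) x) + m (n + 1) x $ 0"
      using \<gamma>_top nr by (simp add: lessThan_Suc_atMost[symmetric] component_def)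
    also have "(\<Sum>K<q. op_app (\<gamma> (Suc K)) (component m 0) (r + K) x)
        = (\<Sum>k=1..q. op_app (\<gamma> k) (component m 0) (n + k - q) x)"
      using nr by (intro sum.reindex_bij_witness[where i = "\<lambda>k. k - 1" and j = Suc])
        (auto intro!: arg_cong[where f = "\<lambda>n. op_app _ _ n x"])
    finally show ?thesis
      using sum_eq by simp
  qed
  have "op_app (det (time_shift \<cdot>\<^sub>m 1\<^sub>m q - A)) (component m 0) n x =
      mat_app (adj_mat (time_shift \<cdot>\<^sub>m 1\<^sub>m q - A)) g n x $ 0"
    if "x \<in> space_lattice dx" for n x
    using q m_dim by (intro op_app_det_component[OF A A_local _ _ g_dim step that]) auto
  with \<gamma>_ring \<gamma>_top scheme show ?thesis
    by blast
qed

end
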